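(* Let $p,q$ be complex numbers. The generating function of the products $j_{p,q,n}j_{p,q,2n}$ of $(p,q)$-Jacobsthal Lucas numbers is, as a formal power series in $z$, $$\sum_{n=0}^{\infty}j_{p,q,n}j_{p,q,2n}z^n=\frac{4-3p(p^2+4q)z-4q(p^4+6p^2q+8q^2)z^2+8pq^3(p^2+4q)z^3}{1-p(p^2+4q)z-2q(p^4+6p^2q+8q^2)z^2+8pq^3(p^2+4q)z^3+64q^6z^4}.$$
   Context: The $(p,q)$-Jacobsthal Lucas numbers are defined by $j_{p,q,0}=2$, $j_{p,q,1}=p$, and $j_{p,q,n}=pj_{p,q,n-1}+2qj_{p,q,n-2}$ for $n\ge 2$. *)

theory Defs
  imports Complex_Main "HOL-Computational_Algebra.Formal_Power_Series"
begin

fun jacobsthal_lucas :: "complex \<Rightarrow> complex \<Rightarrow> nat \<Rightarrow> complex" where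
  "jacobsthal_lucas p q 0 = 2"
| "jacobsthal_lucas p q (Suc 0) = p"
| "jacobsthal_lucas p q (Suc (Suc n)) =
     p * jacobsthal_lucas p q (Suc n) + 2 * q * jacobsthal_lucas p q n"

end

theory Submission imports Defs begin

text \<open>Let a and b be the roots of t^2 - p t - 2q, so that a + b = p and a b = -2q. By
  Binet's formula the products are sums of n-th powers of the numbers a^3, b^3, a^2 b and a b^2, and the
  denominator of the generating function is the polynomial with reciprocal roots at these four numbers.\<close>

lemma quadratic_roots_exist:
  fixes s t :: complex
  obtains a b where "a + b = s" and "a * b = t"
proof
  let ?d = "csqrt (s\<^sup>2 - 4 * t)"
  show "(s + ?d) / 2 + (s - ?d) / 2 = s"
    by (simp add: field_simps)
  have "(s + ?d) / 2 * ((s - ?d) / 2) = (s\<^sup>2 - ?d\<^sup>2) / 4"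
    by (simp add: algebra_simps power2_eq_square)
  also have "\<dots> = t"
    by simp
  finally show "(s + ?d) / 2 * ((s - ?d) / 2) = t" .
qed

text \<open>Both sides obey the same second-order recurrence and agree at 0 and 1. As a plain power
  sum, the formula also covers a double root \<open>a = b\<close>.\<close>

lemma jacobsthal_lucas_binet:
  assumes "a + b = p" and "a * b = - 2 * q"
  shows "jacobsthal_lucas p q n = a ^ n + b ^ n"
proof (induction n rule: induct_nat_012)
  case (ge2 n)
  have "a ^ Suc (Suc n) + b ^ Suc (Suc n) =
      (a + b) * (a ^ Suc n + b ^ Suc n) - a * b * (a ^ n + b ^ n)"
    by (simp add: algebra_simps)
  then show ?case
    using ge2 assms by simp
qed (use assms in simp_all)

text \<open>Expanding \<open>(a ^ n + b ^ n) * (a ^ (2 * n) + b ^ (2 * n))\<close> gives four terms,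
  each an n-th power.\<close>

lemma jacobsthal_lucas_product_binet:
  assumes "a + b = p" and "a * b = - 2 * q"
  shows "jacobsthal_lucas p q n * jacobsthal_lucas p q (2 * n) =
    (a ^ 3) ^ n + (b ^ 3) ^ n + (a ^ 2 * b) ^ n + (a * b ^ 2) ^ n"
  unfolding jacobsthal_lucas_binet[OF assms]
  by (simp add: power_mult power_mult_distrib power_commutes algebra_simps power2_eq_square power3_eq_cube)

text \<open>Four geometric series are put over a common denominator; \<open>e1\<close> to
  \<open>e4\<close> are the elementary symmetric polynomials. The numerator sums the products of
  three of the four linear factors, so a monomial of degree k occurs once for each of the 4 - k
  variables outside it.\<close>

lemma power_sum_fps_4:
  fixes x y z w :: "'a::field"
  defines "e1 \<equiv> x + y + z + w"
    and "e2 \<equiv> x * y + x * z + x * w + y * z + y * w + z * w"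
    and "e3 \<equiv> x * y * z + x * y * w + x * z * w + y * z * w"
    and "e4 \<equiv> x * y * z * w"
  shows "Abs_fps (\<lambda>n. x ^ n + y ^ n + z ^ n + w ^ n) =
    (4 - fps_const (3 * e1) * fps_X + fps_const (2 * e2) * fps_X ^ 2 - fps_const e3 * fps_X ^ 3) /
    (1 - fps_const e1 * fps_X + fps_const e2 * fps_X ^ 2 - fps_const e3 * fps_X ^ 3
       + fps_const e4 * fps_X ^ 4)"
    (is "?F = ?N / ?D")
proof -
  define L where "L c = 1 - fps_const c * fps_X" for c :: 'a
  have geometric: "Abs_fps (\<lambda>n. c ^ n) * L c = 1" for c
  proof (rule fps_ext)
    fix n
    show "fps_nth (Abs_fps (\<lambda>n. c ^ n) * L c) n = fps_nth 1 n"
      \<comment> \<open>Coefficient 0 is 1; at \<open>Suc m\<close> the terms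
        \<open>c ^ Suc m\<close> and \<open>c ^ m * c\<close> cancel.\<close>
      by (cases n) (simp_all add: L_def right_diff_distrib flip: mult.assoc)
  qed
  have F: "?F = Abs_fps (\<lambda>n. x ^ n) + Abs_fps (\<lambda>n. y ^ n) + Abs_fps (\<lambda>n. z ^ n)
      + Abs_fps (\<lambda>n. w ^ n)"
    by (rule fps_ext) simp
  have D: "?D = L x * L y * L z * L w"
    \<comment> \<open>Splitting \<open>fps_const\<close> over sums and products leaves a polynomial
      identity in the constants and \<open>fps_X\<close>.\<close>
    unfolding L_def e1_def e2_def e3_def e4_def
      fps_const_add[symmetric] fps_const_mult[symmetric]
    by algebra
  have "?F * ?D = L y * L z * L w + L x * L z * L w + L x * L y * L w + L x * L y * L z"
    \<comment> \<open>Each series cancels its own factor of \<open>?D\<close>, leaving the other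
      three.\<close>
    unfolding F D using geometric[of x] geometric[of y] geometric[of z] geometric[of w]
    by algebra
  also have "\<dots> = ?N"
    unfolding L_def e1_def e2_def e3_def e4_def
      fps_const_add[symmetric] fps_const_mult[symmetric] numeral_fps_const[symmetric]
    by algebra
  finally have product: "?F * ?D = ?N" .
  \<comment> \<open>The constant coefficient of \<open>?D\<close> is 1.\<close>
  have "?D \<noteq> 0"
  proof
    assume "?D = 0"
    then have "fps_nth ?D 0 = 0"
      by (simp only: fps_zero_nth)
    then show False
      by simp
  qed
  then have "?F * ?D / ?D = ?F"
    by (rule nonzero_mult_div_cancel_right)
  then show ?thesis
    unfolding product by (rule sym)
qed

theorem theorem16:
  fixes p q :: complex
  shows "Abs_fps (\<lambda>n. jacobsthal_lucas p q n * jacobsthal_lucas p q (2 * n)) =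
    (4 - fps_const (3 * p * (p ^ 2 + 4 * q)) * fps_X
       - fps_const (4 * q * (p ^ 4 + 6 * p ^ 2 * q + 8 * q ^ 2)) * fps_X ^ 2
       + fps_const (8 * p * q ^ 3 * (p ^ 2 + 4 * q)) * fps_X ^ 3) /
    (1 - fps_const (p * (p ^ 2 + 4 * q)) * fps_X
       - fps_const (2 * q * (p ^ 4 + 6 * p ^ 2 * q + 8 * q ^ 2)) * fps_X ^ 2
       + fps_const (8 * p * q ^ 3 * (p ^ 2 + 4 * q)) * fps_X ^ 3
       + fps_const (64 * q ^ 6) * fps_X ^ 4)"
proof -
  obtain a b where ab: "a + b = p" "a * b = - 2 * q"
    by (rule quadratic_roots_exist)
  then have p: "p = a + b" and q: "q = - (a * b) / 2"
    by simp_all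
  let ?x = "a ^ 3" and ?y = "b ^ 3" and ?z = "a ^ 2 * b" and ?w = "a * b ^ 2"
  \<comment> \<open>Here \<open>p ^ 2 + 4 * q\<close> is \<open>a ^ 2 + b ^ 2\<close>, and
    \<open>e3\<close> is \<open>(a * b) ^ 3\<close> times \<open>e1\<close>. The quartic factor in
    \<open>e2\<close> is \<open>(p ^ 2 + 2 * q) * (p ^ 2 + 4 * q)\<close>.\<close>
  have e1: "?x + ?y + ?z + ?w = p * (p ^ 2 + 4 * q)"
    unfolding p q by (simp add: field_simps eval_nat_numeral)
  have e2: "?x * ?y + ?x * ?z + ?x * ?w + ?y * ?z + ?y * ?w + ?z * ?w =
      - (2 * q * (p ^ 4 + 6 * p ^ 2 * q + 8 * q ^ 2))"
    unfolding p q by (simp add: field_simps eval_nat_numeral)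
  have e3: "?x * ?y * ?z + ?x * ?y * ?w + ?x * ?z * ?w + ?y * ?z * ?w =
      - (8 * p * q ^ 3 * (p ^ 2 + 4 * q))"
    unfolding p q by (simp add: field_simps eval_nat_numeral)
  have e4: "?x * ?y * ?z * ?w = 64 * q ^ 6"
    unfolding p q by (simp add: field_simps eval_nat_numeral)
  have c1: "3 * (p * (p ^ 2 + 4 * q)) = 3 * p * (p ^ 2 + 4 * q)"
    and c2: "2 * - (2 * q * (p ^ 4 + 6 * p ^ 2 * q + 8 * q ^ 2)) =
      - (4 * q * (p ^ 4 + 6 * p ^ 2 * q + 8 * q ^ 2))"
    by simp_all
  \<comment> \<open>The second and third symmetric polynomials carry a minus sign, which flips the
    signs of the quadratic and cubic terms.\<close>
  have neg: "u + fps_const (- c) * v = u - fps_const c * v"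
    "u - fps_const (- c) * v = u + fps_const c * v" for u v and c :: complex
    by (simp_all flip: fps_const_neg)
  show ?thesis
    unfolding jacobsthal_lucas_product_binet[OF ab] power_sum_fps_4 e1 e2 e3 e4 c1 c2 neg ..
qed

end
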